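(* Let $\{w_n\}_{n\in\mathbb{N}}$ be a sequence of non-negative real numbers, $r$ a fixed relative quota, and $\mu$ a probability measure on $[0,1]$ with $\mu([\frac12+a,\frac12+b])=\mu([\frac12-b,\frac12-a])$ for all $a\le b$ with $[\frac12+a,\frac12+b]\subset[0,1]$. For each $N$ consider the voting system $(V_N,\mathcal{V}_N)$ with weights $w_1,\ldots,w_N$ and relative quota $r$, together with the voting measure $\mathbb{P}_\mu$ on $V_N$. If $LT_N\to0$ as $N\to\infty$ and $\mu(\{r\})=0$, then for every fixed voter $v$ the rates of success with respect to $\mathbb{P}_\mu$ satisfy, as $N\to\infty$, $$S^+_{\mathbb{P}_\mu}(v)\to\int_r^1p\,d\mu(p),$$ $$S^-_{\mathbb{P}_\mu}(v)\to\int_{1-r}^1p\,d\mu(p).$$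
   Context: $V_N=\{1,\ldots,N\}$, and a coalition $A\subset V_N$ is winning, $A\in\mathcal{V}_N$, if and only if $\sum_{i\in A}w_i\ge r\sum_{i=1}^Nw_i$. By definition of a voting system, $V_N\in\mathcal{V}_N$ and $\emptyset\notin\mathcal{V}_N$, so $0<r\le1$ and $\sum_{i=1}^N w_i>0$ (for the $N$ under consideration). The Laakso-Taagepera index of the sequence is $LT_N=\dfrac{\sum_{n=1}^Nw_n^2}{\left(\sum_{n=1}^Nw_n\right)^2}$. The common belief measure $\mathbb{P}_\mu$ is the probability measure on the power set of $V_N$ giving each coalition $A\subset V_N$ the probability $\mathbb{P}_\mu(A)=\int_0^1p^{|A|}(1-p)^{N-|A|}\,d\mu(p)$. The rate of affirmative success of a voter $v\in V_N$ is $S^+_{\mathbb{P}_\mu}(v)=\mathbb{P}_\mu(\{A\in\mathcal{V}_N\mid v\in A\})$, and the rate of blocking success is $S^-_{\mathbb{P}_\mu}(v)=\mathbb{P}_\mu(\{A\subset V_N\mid A\notin\mathcal{V}_N, v\notin A\})$. *)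

theory Defs
  imports "HOL-Probability.Probability"
begin

definition voters :: "nat \<Rightarrow> nat set" where
  "voters N = {1..N}"

text \<open>Monotonicity of the set of winning coalitions is not demanded here; it is automatic for
  the weighted systems below when the weights are non-negative.\<close>

definition voting_system :: "'a set \<Rightarrow> 'a set set \<Rightarrow> bool" where
  "voting_system V W \<longleftrightarrow> finite V \<and> W \<subseteq> Pow V \<and> V \<in> W \<and> {} \<notin> W"

definition winning :: "(nat \<Rightarrow> real) \<Rightarrow> real \<Rightarrow> nat \<Rightarrow> nat set set" where
  "winning w r N = {A. A \<subseteq> voters N \<and> (\<Sum>i\<in>A. w i) \<ge> r * (\<Sum>i\<in>voters N. w i)}"

definition laakso_taagepera :: "(nat \<Rightarrow> real) \<Rightarrow> nat \<Rightarrow> real" where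
  "laakso_taagepera w N = (\<Sum>n=1..N. (w n)\<^sup>2) / (\<Sum>n=1..N. w n)\<^sup>2"

definition common_belief_weight :: "real measure \<Rightarrow> nat \<Rightarrow> nat set \<Rightarrow> real" where
  "common_belief_weight \<mu> N A = (LINT p|\<mu>. p ^ card A * (1 - p) ^ (N - card A))"

definition common_belief_measure :: "real measure \<Rightarrow> nat \<Rightarrow> nat set measure" where
  "common_belief_measure \<mu> N =
     point_measure (Pow (voters N)) (\<lambda>A. ennreal (common_belief_weight \<mu> N A))"

definition affirmative_success :: "'a set measure \<Rightarrow> 'a set set \<Rightarrow> 'a \<Rightarrow> real" where
  "affirmative_success P W v = measure P {A \<in> W. v \<in> A}"

definition blocking_success :: "'a set measure \<Rightarrow> 'a set \<Rightarrow> 'a set set \<Rightarrow> 'a \<Rightarrow> real" where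
  "blocking_success P V W v = measure P {A. A \<subseteq> V \<and> A \<notin> W \<and> v \<notin> A}"

definition prob_measure_on_unit_interval :: "real measure \<Rightarrow> bool" where
  "prob_measure_on_unit_interval \<mu> \<longleftrightarrow>
     prob_space \<mu> \<and> sets \<mu> = sets (restrict_space borel {0..1})"

text \<open>As \<open>a\<close> and \<open>b\<close> range over all reals, the intervals need not lie on one side of \<open>1/2\<close>.\<close>

definition symmetric_about_half :: "real measure \<Rightarrow> bool" where
  "symmetric_about_half \<mu> \<longleftrightarrow>
     (\<forall>a b. a \<le> b \<longrightarrow> {1/2 + a..1/2 + b} \<subseteq> {0..1} \<longrightarrow>
        measure \<mu> {1/2 + a..1/2 + b} = measure \<mu> {1/2 - b..1/2 - a})"

text \<open>Sanity checks: the weights above are probabilities of coalitions and they add up to one.\<close>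

lemma common_belief_integrable:
  assumes "prob_measure_on_unit_interval \<mu>"
  shows "integrable \<mu> (\<lambda>p. p ^ k * (1 - p) ^ l)"
proof -
  interpret prob_space \<mu>
    using assms by (simp add: prob_measure_on_unit_interval_def)
  have s: "sets \<mu> = sets (restrict_space borel {0..1})"
    using assms by (simp add: prob_measure_on_unit_interval_def)
  have sp: "space \<mu> = {0..1}"
    using sets_eq_imp_space_eq[OF s] by (simp add: space_restrict_space)
  show ?thesis
  proof (rule integrable_const_bound[where B = 1])
    show "AE p in \<mu>. norm (p ^ k * (1 - p) ^ l) \<le> 1"
      by (rule AE_I2) (auto simp: sp abs_mult power_abs intro!: mult_le_one power_le_one)
    have "(\<lambda>p::real. p ^ k * (1 - p) ^ l) \<in> borel_measurable (restrict_space borel {0..1})"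
      by (rule measurable_restrict_space1) simp
    then show "(\<lambda>p. p ^ k * (1 - p) ^ l) \<in> borel_measurable \<mu>"
      using measurable_cong_sets[OF s refl] by blast
  qed
qed

lemma common_belief_weight_nonneg:
  assumes "prob_measure_on_unit_interval \<mu>"
  shows "0 \<le> common_belief_weight \<mu> N A"
proof -
  have "sets \<mu> = sets (restrict_space borel {0..1})"
    using assms by (simp add: prob_measure_on_unit_interval_def)
  from sets_eq_imp_space_eq[OF this] have sp: "space \<mu> = {0..1}"
    by (simp add: space_restrict_space)
  show ?thesis
    unfolding common_belief_weight_def
    by (rule Bochner_Integration.integral_nonneg) (auto simp: sp)
qed

lemma prob_space_common_belief_measure:
  assumes \<mu>: "prob_measure_on_unit_interval \<mu>"
  shows "prob_space (common_belief_measure \<mu> N)"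
proof
  interpret prob_space \<mu>
    using assms by (simp add: prob_measure_on_unit_interval_def)
  have fin: "finite (Pow (voters N))" by (simp add: voters_def)
  have bin: "(\<Sum>A\<in>Pow (voters N). p ^ card A * (1 - p) ^ (N - card A)) = 1" for p :: real
  proof -
    have "(\<Sum>A\<in>Pow (voters N). p ^ card A * (1 - p) ^ (N - card A))
        = (\<Sum>A\<in>Pow (voters N). (\<Prod>i\<in>A. p) * (\<Prod>i\<in>voters N - A. 1 - p))"
      by (rule sum.cong) (auto simp: voters_def card_Diff_subset finite_subset)
    also have "\<dots> = (\<Prod>i\<in>voters N. p + (1 - p))"
      by (rule prod_add[symmetric]) (simp add: voters_def)
    finally show ?thesis by simp
  qed
  have "(\<Sum>A\<in>Pow (voters N). common_belief_weight \<mu> N A)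
      = (LINT p|\<mu>. (\<Sum>A\<in>Pow (voters N). p ^ card A * (1 - p) ^ (N - card A)))"
    unfolding common_belief_weight_def
    by (rule Bochner_Integration.integral_sum[symmetric]) (rule common_belief_integrable[OF \<mu>])
  also have "\<dots> = 1" by (simp add: bin prob_space)
  finally have one: "(\<Sum>A\<in>Pow (voters N). common_belief_weight \<mu> N A) = 1" .
  have "emeasure (common_belief_measure \<mu> N) (Pow (voters N))
      = (\<Sum>A\<in>Pow (voters N). ennreal (common_belief_weight \<mu> N A))"
    unfolding common_belief_measure_def
    by (rule emeasure_point_measure_finite[OF fin subset_refl])
  also have "\<dots> = 1"
    by (subst sum_ennreal) (simp_all add: common_belief_weight_nonneg[OF \<mu>] one)
  finally show "emeasure (common_belief_measure \<mu> N) (space (common_belief_measure \<mu> N)) = 1"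
    by (simp add: common_belief_measure_def space_point_measure)
qed

end

theory Submission
  imports Defs
begin

text \<open>Given the common belief \<open>p\<close>, the voters vote independently, each in favour with probability
  \<open>p\<close>. The weight of the resulting random coalition has mean \<open>p\<close> times the total weight, and the
  variance of its share of the total weight is \<open>p * (1 - p)\<close> times the Laakso-Taagepera index. As the
  index tends to \<open>0\<close>, Chebyshev's inequality makes the vote deterministic in the limit: for
  \<open>p > r\<close> the coalition wins, for \<open>p < r\<close> it loses, with probability tending to \<open>1\<close>
  (\<open>bernoulli_quota_concentration\<close>). The vote of a single voter is unaffected, so the conditional
  probability of affirmative success tends to \<open>p\<close> if \<open>p > r\<close> and to \<open>0\<close> if \<open>p < r\<close>, and that of
  blocking success to \<open>1 - p\<close> if \<open>p < r\<close> and to \<open>0\<close> if \<open>p > r\<close>.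

  The success rates are the integrals of these conditional probabilities over \<open>\<mu>\<close>, and dominated
  convergence carries the limit under the integral because \<open>\<mu>\<close> does not charge \<open>r\<close>
  (\<open>integral_bernoulli_expectation_tendsto\<close>). The limit of the blocking rate is then the integral of
  \<open>1 - p\<close> over \<open>p \<le> r\<close>; the reflection \<open>p \<mapsto> 1 - p\<close>, which preserves the symmetric measure
  \<open>\<mu>\<close> (\<open>integral_reflect_symmetric\<close>), turns it into the integral of \<open>p\<close> over \<open>p \<ge> 1 - r\<close>.\<close>

section \<open>Independent voting with a fixed belief\<close>

definition bernoulli_expectation :: "real \<Rightarrow> 'a set \<Rightarrow> ('a set \<Rightarrow> real) \<Rightarrow> real" where
  "bernoulli_expectation p V f =
     (\<Sum>A\<in>Pow V. p ^ card A * (1 - p) ^ (card V - card A) * f A)"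

lemma bernoulli_expectation_empty [simp]: "bernoulli_expectation p {} f = f {}"
  by (simp add: bernoulli_expectation_def)

lemma bernoulli_expectation_insert:
  assumes "finite V" and "x \<notin> V"
  shows "bernoulli_expectation p (insert x V) f =
           p * bernoulli_expectation p V (\<lambda>A. f (insert x A)) + (1 - p) * bernoulli_expectation p V f"
proof -
  let ?q = "\<lambda>A. p ^ card A * (1 - p) ^ (card (insert x V) - card A) * f A"
  have fin: "finite A" "x \<notin> A" "card A \<le> card V" if "A \<in> Pow V" for A
    using that assms by (auto intro: finite_subset card_mono)
  have inj: "inj_on (insert x) (Pow V)"
    using assms(2) by (intro inj_onI) (metis PowD insert_ident subsetD)
  have "bernoulli_expectation p (insert x V) f = sum ?q (Pow V) + sum ?q (insert x ` Pow V)"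
    unfolding bernoulli_expectation_def Pow_insert
    by (rule sum.union_disjoint) (use assms in auto)
  also have "sum ?q (Pow V) = (1 - p) * bernoulli_expectation p V f"
    unfolding bernoulli_expectation_def sum_distrib_left
    by (rule sum.cong) (auto simp: assms fin Suc_diff_le)
  also have "sum ?q (insert x ` Pow V) = p * bernoulli_expectation p V (\<lambda>A. f (insert x A))"
    unfolding bernoulli_expectation_def sum_distrib_left sum.reindex[OF inj]
    by (rule sum.cong) (auto simp: assms fin)
  finally show ?thesis by simp
qed

lemma bernoulli_expectation_const:
  assumes "finite V"
  shows "bernoulli_expectation p V (\<lambda>_. c) = c"
  using assms by induction (simp_all add: bernoulli_expectation_insert algebra_simps)

lemma bernoulli_expectation_diff:
  "bernoulli_expectation p V (\<lambda>A. f A - g A) =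
     bernoulli_expectation p V f - bernoulli_expectation p V g"
  by (simp add: bernoulli_expectation_def algebra_simps sum_subtractf)

lemma bernoulli_expectation_cmult:
  "bernoulli_expectation p V (\<lambda>A. c * f A) = c * bernoulli_expectation p V f"
  by (simp add: bernoulli_expectation_def sum_distrib_left mult_ac)

lemma bernoulli_expectation_mono:
  assumes "0 \<le> p" "p \<le> 1" and "\<And>A. A \<subseteq> V \<Longrightarrow> f A \<le> g A"
  shows "bernoulli_expectation p V f \<le> bernoulli_expectation p V g"
  unfolding bernoulli_expectation_def
  by (intro sum_mono mult_left_mono) (use assms in auto)

lemma abs_bernoulli_expectation_le:
  assumes "0 \<le> p" "p \<le> 1"
  shows "\<bar>bernoulli_expectation p V f\<bar> \<le> bernoulli_expectation p V (\<lambda>A. \<bar>f A\<bar>)"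
proof -
  have "\<bar>bernoulli_expectation p V f\<bar> \<le>
          (\<Sum>A\<in>Pow V. \<bar>p ^ card A * (1 - p) ^ (card V - card A) * f A\<bar>)"
    unfolding bernoulli_expectation_def by (rule sum_abs)
  also have "\<dots> = bernoulli_expectation p V (\<lambda>A. \<bar>f A\<bar>)"
    using assms by (simp add: bernoulli_expectation_def abs_mult)
  finally show ?thesis .
qed

lemma bernoulli_prob_member:
  assumes "finite V" and "v \<in> V"
  shows "bernoulli_expectation p V (\<lambda>A. of_bool (v \<in> A)) = p"
proof -
  have "bernoulli_expectation p (insert v (V - {v})) (\<lambda>A. of_bool (v \<in> A)) =
      p + (1 - p) * bernoulli_expectation p (V - {v}) (\<lambda>A. of_bool (v \<in> A))"
    using assms by (subst bernoulli_expectation_insert) (simp_all add: bernoulli_expectation_const)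
  also have "bernoulli_expectation p (V - {v}) (\<lambda>A. of_bool (v \<in> A)) = 0"
    unfolding bernoulli_expectation_def by (rule sum.neutral) auto
  finally show ?thesis
    using assms by (simp add: insert_absorb)
qed

text \<open>The displacement \<open>c\<close> makes the induction over the voters work: conditioning on the vote of one
  voter \<open>x\<close> changes it to \<open>c + (1 - p) * w x\<close> (in favour) or to \<open>c - p * w x\<close> (against), and the
  squares of the two new displacements average to \<open>c\<^sup>2 + p * (1 - p) * (w x)\<^sup>2\<close>. The case
  \<open>c = 0\<close> is the variance of the weight of a random coalition.\<close>

lemma bernoulli_second_moment:
  fixes w :: "'a \<Rightarrow> real"
  assumes "finite V"
  shows "bernoulli_expectation p V (\<lambda>A. (sum w A - p * sum w V + c)\<^sup>2) =
           p * (1 - p) * (\<Sum>i\<in>V. (w i)\<^sup>2) + c\<^sup>2"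
  using assms
proof (induction V arbitrary: c)
  case empty
  show ?case by simp
next
  case (insert x V)
  have ins: "bernoulli_expectation p V (\<lambda>A. (sum w (insert x A) - p * sum w (insert x V) + c)\<^sup>2) =
      bernoulli_expectation p V (\<lambda>A. (sum w A - p * sum w V + (c + (1 - p) * w x))\<^sup>2)"
    unfolding bernoulli_expectation_def
  proof (rule sum.cong)
    fix A assume "A \<in> Pow V"
    then have "finite A" "x \<notin> A"
      using insert.hyps by (auto intro: finite_subset)
    then have "sum w (insert x A) - p * sum w (insert x V) + c =
        sum w A - p * sum w V + (c + (1 - p) * w x)"
      using insert.hyps by (simp add: algebra_simps)
    then show "p ^ card A * (1 - p) ^ (card V - card A) *
          (sum w (insert x A) - p * sum w (insert x V) + c)\<^sup>2 =
        p ^ card A * (1 - p) ^ (card V - card A) *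
          (sum w A - p * sum w V + (c + (1 - p) * w x))\<^sup>2"
      by (simp only:)
  qed simp
  have del: "bernoulli_expectation p V (\<lambda>A. (sum w A - p * sum w (insert x V) + c)\<^sup>2) =
      bernoulli_expectation p V (\<lambda>A. (sum w A - p * sum w V + (c - p * w x))\<^sup>2)"
    using insert.hyps by (simp add: algebra_simps)
  show ?case
    unfolding bernoulli_expectation_insert[OF insert.hyps] ins del insert.IH
    using insert.hyps by (simp add: power2_eq_square algebra_simps)
qed

section \<open>Concentration of the weight of a coalition\<close>

text \<open>The coalitions whose status differs from the one that the sign of \<open>p - r\<close> predicts have a
  weight that deviates from its mean \<open>p * sum w V\<close> by at least \<open>\<bar>p - r\<bar> * sum w V\<close>. Chebyshev's
  inequality bounds their probability by the variance over the square of this deviation, and they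
  are the only coalitions that contribute to the difference. The factor \<open>h\<close> serves to
  prescribe the vote of a single voter.\<close>

lemma bernoulli_quota_concentration:
  fixes w :: "'a \<Rightarrow> real"
  assumes fin: "finite V" and W: "sum w V > 0" and p: "0 \<le> p" "p \<le> 1" "p \<noteq> r"
    and h: "\<And>A. A \<subseteq> V \<Longrightarrow> \<bar>h A\<bar> \<le> 1"
  shows "\<bar>bernoulli_expectation p V (\<lambda>A. of_bool (r * sum w V \<le> sum w A) * h A) -
            of_bool (r \<le> p) * bernoulli_expectation p V h\<bar>
         \<le> (\<Sum>i\<in>V. (w i)\<^sup>2) / (sum w V)\<^sup>2 / (p - r)\<^sup>2"
proof -
  define D where "D = ((p - r) * sum w V)\<^sup>2"
  have D: "D > 0" using p W by (simp add: D_def)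
  have pointwise: "\<bar>of_bool (r * sum w V \<le> sum w A) * h A - of_bool (r \<le> p) * h A\<bar>
      \<le> 1 / D * (sum w A - p * sum w V + 0)\<^sup>2" if A: "A \<subseteq> V" for A
  proof (cases "r * sum w V \<le> sum w A \<longleftrightarrow> r \<le> p")
    case True
    then show ?thesis using D by auto
  next
    case False
    have "\<bar>(p - r) * sum w V\<bar> \<le> \<bar>sum w A - p * sum w V\<bar>"
    proof (cases "r \<le> p")
      case True
      then have "0 \<le> (p - r) * sum w V" using W by simp
      with True False show ?thesis by (simp add: algebra_simps)
    next
      case less: False
      then have "(p - r) * sum w V \<le> 0" using W by (simp add: mult_le_0_iff)
      with less False show ?thesis by (simp add: algebra_simps)
    qed
    then have "D \<le> (sum w A - p * sum w V)\<^sup>2"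
      unfolding D_def by (simp add: abs_le_square_iff)
    then have "1 \<le> 1 / D * (sum w A - p * sum w V + 0)\<^sup>2"
      using D by simp
    moreover have "\<bar>of_bool (r * sum w V \<le> sum w A) * h A - of_bool (r \<le> p) * h A\<bar> \<le> 1"
      using h[OF A] by auto
    ultimately show ?thesis by linarith
  qed
  have "\<bar>bernoulli_expectation p V (\<lambda>A. of_bool (r * sum w V \<le> sum w A) * h A) -
            of_bool (r \<le> p) * bernoulli_expectation p V h\<bar> =
      \<bar>bernoulli_expectation p V (\<lambda>A. of_bool (r * sum w V \<le> sum w A) * h A - of_bool (r \<le> p) * h A)\<bar>"
    by (simp only: bernoulli_expectation_diff bernoulli_expectation_cmult)
  also have "\<dots> \<le> bernoulli_expectation p V
      (\<lambda>A. \<bar>of_bool (r * sum w V \<le> sum w A) * h A - of_bool (r \<le> p) * h A\<bar>)"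
    using p by (intro abs_bernoulli_expectation_le)
  also have "\<dots> \<le> bernoulli_expectation p V (\<lambda>A. 1 / D * (sum w A - p * sum w V + 0)\<^sup>2)"
    using p pointwise by (intro bernoulli_expectation_mono) auto
  also have "\<dots> = 1 / D * (p * (1 - p) * (\<Sum>i\<in>V. (w i)\<^sup>2))"
    by (simp only: bernoulli_expectation_cmult bernoulli_second_moment[OF fin]) simp
  also have "\<dots> \<le> 1 / D * (1 * (\<Sum>i\<in>V. (w i)\<^sup>2))"
    using D p by (intro mult_left_mono mult_right_mono mult_le_one) (auto intro: sum_nonneg)
  also have "\<dots> = (\<Sum>i\<in>V. (w i)\<^sup>2) / (sum w V)\<^sup>2 / (p - r)\<^sup>2"
    by (simp add: D_def power_mult_distrib mult.commute)
  finally show ?thesis .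
qed

text \<open>The empty coalition loses, so the absolute quota \<open>r * sum w (voters N)\<close> is positive; the full
  coalition wins, so this quota is at most the total weight.\<close>

lemma voting_system_winningD:
  assumes "voting_system (voters N) (winning w r N)" and "\<And>n. n \<ge> 1 \<Longrightarrow> w n \<ge> 0"
  shows "sum w (voters N) > 0" and "0 < r" and "r \<le> 1"
proof -
  have V: "r * sum w (voters N) \<le> sum w (voters N)" and E: "r * sum w (voters N) > 0"
    using assms(1) by (auto simp: voting_system_def winning_def not_le)
  have "sum w (voters N) \<ge> 0"
    using assms(2) by (intro sum_nonneg) (auto simp: voters_def)
  with E show W: "sum w (voters N) > 0"
    by (cases "sum w (voters N) = 0") auto
  show "0 < r" using E W by (simp add: zero_less_mult_iff)
  show "r \<le> 1" using V W by simp
qed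

text \<open>For a fixed belief \<open>p \<noteq> r\<close> the law of large numbers decides the vote in the limit.
  The expectation of \<open>h\<close> is only eventually constant in the application, since a voter \<open>v\<close> takes part
  from \<open>N = v\<close> on.\<close>

lemma bernoulli_winning_tendsto:
  assumes w_nonneg: "\<And>n. n \<ge> 1 \<Longrightarrow> w n \<ge> 0"
    and vs: "eventually (\<lambda>N. voting_system (voters N) (winning w r N)) sequentially"
    and LT: "laakso_taagepera w \<longlonglongrightarrow> 0"
    and p: "0 \<le> p" "p \<le> 1" "p \<noteq> r"
    and h: "\<And>A. \<bar>h A\<bar> \<le> 1"
    and H: "eventually (\<lambda>N. bernoulli_expectation p (voters N) h = H) sequentially"
  shows "(\<lambda>N. bernoulli_expectation p (voters N) (\<lambda>A. of_bool (A \<in> winning w r N) * h A))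
           \<longlonglongrightarrow> of_bool (r \<le> p) * H"
proof -
  have "eventually (\<lambda>N. norm (bernoulli_expectation p (voters N)
            (\<lambda>A. of_bool (A \<in> winning w r N) * h A) - of_bool (r \<le> p) * H)
          \<le> laakso_taagepera w N / (p - r)\<^sup>2) sequentially"
    using vs H
  proof eventually_elim
    case (elim N)
    have win: "bernoulli_expectation p (voters N) (\<lambda>A. of_bool (A \<in> winning w r N) * h A) =
        bernoulli_expectation p (voters N)
          (\<lambda>A. of_bool (r * sum w (voters N) \<le> sum w A) * h A)"
      unfolding bernoulli_expectation_def by (rule sum.cong) (auto simp: winning_def)
    have "\<bar>bernoulli_expectation p (voters N) (\<lambda>A. of_bool (r * sum w (voters N) \<le> sum w A) * h A) -
            of_bool (r \<le> p) * bernoulli_expectation p (voters N) h\<bar>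
         \<le> (\<Sum>i\<in>voters N. (w i)\<^sup>2) / (sum w (voters N))\<^sup>2 / (p - r)\<^sup>2"
      using voting_system_winningD(1)[OF elim(1) w_nonneg] p h
      by (intro bernoulli_quota_concentration) (auto simp: voters_def)
    then show ?case
      unfolding win elim(2) by (simp add: laakso_taagepera_def voters_def)
  qed
  moreover have "(\<lambda>N. laakso_taagepera w N / (p - r)\<^sup>2) \<longlonglongrightarrow> 0"
    using tendsto_divide[OF LT tendsto_const, of "(p - r)\<^sup>2"] p by simp
  ultimately have "(\<lambda>N. bernoulli_expectation p (voters N)
      (\<lambda>A. of_bool (A \<in> winning w r N) * h A) - of_bool (r \<le> p) * H) \<longlonglongrightarrow> 0"
    by (rule Lim_null_comparison)
  then show ?thesis by (simp add: LIM_zero_iff)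
qed

section \<open>Mixing over the common belief\<close>

lemma space_unit_interval_measure:
  assumes "prob_measure_on_unit_interval \<mu>"
  shows "space \<mu> = {0..1}"
  using assms sets_eq_imp_space_eq[of \<mu> "restrict_space borel {0..1}"]
  by (simp add: prob_measure_on_unit_interval_def space_restrict_space)

lemma borel_measurable_unit_interval_measure:
  assumes "prob_measure_on_unit_interval \<mu>" and "f \<in> measurable borel M"
  shows "f \<in> measurable \<mu> M"
proof -
  have "sets \<mu> = sets (restrict_space borel {0..1})"
    using assms(1) by (simp add: prob_measure_on_unit_interval_def)
  moreover have "f \<in> measurable (restrict_space borel {0..1}) M"
    using assms(2) by (rule measurable_restrict_space1)
  ultimately show ?thesis
    using measurable_cong_sets by blast
qed

lemma borel_measurable_bernoulli_expectation:
  "(\<lambda>p. bernoulli_expectation p V f) \<in> borel_measurable borel"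
  unfolding bernoulli_expectation_def by measurable

lemma measure_common_belief_measure:
  assumes \<mu>: "prob_measure_on_unit_interval \<mu>"
  shows "measure (common_belief_measure \<mu> N) {A. A \<subseteq> voters N \<and> P A} =
           (LINT p|\<mu>. bernoulli_expectation p (voters N) (\<lambda>A. of_bool (P A)))"
proof -
  let ?S = "{A. A \<subseteq> voters N \<and> P A}"
  have fin: "finite (Pow (voters N))" by (simp add: voters_def)
  have "emeasure (common_belief_measure \<mu> N) ?S =
      (\<Sum>A\<in>?S. ennreal (common_belief_weight \<mu> N A))"
    unfolding common_belief_measure_def
    by (rule emeasure_point_measure_finite[OF fin]) auto
  also have "\<dots> = ennreal (\<Sum>A\<in>?S. common_belief_weight \<mu> N A)"
    by (rule sum_ennreal) (rule common_belief_weight_nonneg[OF \<mu>])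
  finally have "measure (common_belief_measure \<mu> N) ?S = (\<Sum>A\<in>?S. common_belief_weight \<mu> N A)"
    by (simp add: measure_def sum_nonneg common_belief_weight_nonneg[OF \<mu>])
  also have "\<dots> = (\<Sum>A\<in>Pow (voters N). common_belief_weight \<mu> N A * of_bool (P A))"
    by (rule sum.mono_neutral_cong_left[OF fin]) auto
  also have "\<dots> = (LINT p|\<mu>. bernoulli_expectation p (voters N) (\<lambda>A. of_bool (P A)))"
    unfolding bernoulli_expectation_def common_belief_weight_def
    by (subst Bochner_Integration.integral_sum)
       (auto simp: common_belief_integrable[OF \<mu>] voters_def)
  finally show ?thesis .
qed

text \<open>Bounded convergence for the integral over the belief. The concentration estimate gives
  nothing at the quota itself, which is why \<open>\<mu>\<close> may not charge it.\<close>

lemma integral_bernoulli_expectation_tendsto: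
  assumes \<mu>: "prob_measure_on_unit_interval \<mu>"
    and null: "measure \<mu> {r} = 0" and r: "0 < r" "r \<le> 1"
    and bound: "\<And>N A. \<bar>f N A\<bar> \<le> 1"
    and g: "g \<in> borel_measurable borel"
    and lim: "\<And>p. 0 \<le> p \<Longrightarrow> p \<le> 1 \<Longrightarrow> p \<noteq> r \<Longrightarrow>
      (\<lambda>N. bernoulli_expectation p (voters N) (f N)) \<longlonglongrightarrow> g p"
  shows "(\<lambda>N. LINT p|\<mu>. bernoulli_expectation p (voters N) (f N)) \<longlonglongrightarrow> (LINT p|\<mu>. g p)"
proof -
  interpret prob_space \<mu>
    using \<mu> by (simp add: prob_measure_on_unit_interval_def)
  note space = space_unit_interval_measure[OF \<mu>]
  have "{r} \<in> sets \<mu>"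
    using \<mu> r by (auto simp: prob_measure_on_unit_interval_def sets_restrict_space)
  with null have "{r} \<in> null_sets \<mu>"
    by (simp add: null_sets_def emeasure_eq_measure)
  then have ne: "AE p in \<mu>. p \<noteq> r"
    using AE_not_in by fastforce
  show ?thesis
  proof (rule integral_dominated_convergence[where w = "\<lambda>_. 1"])
    show "AE p in \<mu>. (\<lambda>N. bernoulli_expectation p (voters N) (f N)) \<longlonglongrightarrow> g p"
      using ne AE_space by eventually_elim (auto simp: space lim)
    show "AE p in \<mu>. norm (bernoulli_expectation p (voters N) (f N)) \<le> 1" for N
    proof (rule AE_I2)
      fix p assume "p \<in> space \<mu>"
      then have p: "0 \<le> p" "p \<le> 1" by (auto simp: space)
      have "bernoulli_expectation p (voters N) (\<lambda>A. \<bar>f N A\<bar>) \<le>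
          bernoulli_expectation p (voters N) (\<lambda>_. 1)"
        using p bound by (intro bernoulli_expectation_mono) auto
      with abs_bernoulli_expectation_le[OF p, of "voters N" "f N"]
      show "norm (bernoulli_expectation p (voters N) (f N)) \<le> 1"
        by (simp add: bernoulli_expectation_const voters_def)
    qed
  qed (auto intro!: borel_measurable_unit_interval_measure[OF \<mu>] g
        borel_measurable_bernoulli_expectation)
qed

section \<open>Symmetry of the belief\<close>

text \<open>A symmetric measure is invariant under the reflection \<open>p \<mapsto> 1 - p\<close>: the intervals
  \<open>{0..x}\<close> and \<open>{1 - x..1}\<close> have equal mass if \<open>0 \<le> x \<le> 1\<close>, so the
  measure and its image have the same distribution function.\<close>

lemma integral_reflect_symmetric:
  fixes f :: "real \<Rightarrow> real"
  assumes \<mu>: "prob_measure_on_unit_interval \<mu>" and sym: "symmetric_about_half \<mu>"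
    and f: "f \<in> borel_measurable borel"
  shows "(LINT p|\<mu>. f (1 - p)) = (LINT p|\<mu>. f p)"
proof -
  interpret prob_space \<mu>
    using \<mu> by (simp add: prob_measure_on_unit_interval_def)
  note space = space_unit_interval_measure[OF \<mu>]
  have id [measurable]: "(\<lambda>p. p) \<in> measurable \<mu> borel"
    by (rule borel_measurable_unit_interval_measure[OF \<mu>]) simp
  have refl [measurable]: "(\<lambda>p. 1 - p) \<in> measurable \<mu> borel"
    by measurable
  have "distr \<mu> borel (\<lambda>p. 1 - p) = distr \<mu> borel (\<lambda>p. p)"
  proof (rule cdf_unique)
    show "real_distribution (distr \<mu> borel (\<lambda>p. 1 - p))" "real_distribution (distr \<mu> borel (\<lambda>p. p))"
      by (simp_all add: real_distribution_def real_distribution_axioms_def prob_space_distr)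
    show "cdf (distr \<mu> borel (\<lambda>p. 1 - p)) = cdf (distr \<mu> borel (\<lambda>p. p))"
    proof
      fix x :: real
      have "prob {p \<in> {0..1}. 1 - p \<le> x} = prob {p \<in> {0..1}. p \<le> x}"
      proof -
        consider "x < 0" | "0 \<le> x" "x \<le> 1" | "1 < x" by linarith
        then show ?thesis
        proof cases
          case 1
          then have "{p \<in> {0..1}. 1 - p \<le> x} = {}" "{p \<in> {0..1}. p \<le> x} = {}" by auto
          then show ?thesis by (simp only:)
        next
          case 2
          then have eq: "{p \<in> {0..1}. 1 - p \<le> x} = {1/2 - (x - 1/2)..1/2 - (-1/2)}"
              "{p \<in> {0..1}. p \<le> x} = {1/2 + (-1/2)..1/2 + (x - 1/2)}"
            by auto
          show ?thesis
            unfolding eq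
            by (rule sym[unfolded symmetric_about_half_def, rule_format, symmetric]) (use 2 in auto)
        next
          case 3
          then have "{p \<in> {0..1}. 1 - p \<le> x} = {p \<in> {0..1}. p \<le> x}" by auto
          then show ?thesis by (simp only:)
        qed
      qed
      moreover have "(\<lambda>p. 1 - p) -` {..x} \<inter> {0..1} = {p \<in> {0..1}. 1 - p \<le> x}"
          "(\<lambda>p. p) -` {..x} \<inter> {0..1} = {p \<in> {0..1}. p \<le> x}"
        by auto
      ultimately show "cdf (distr \<mu> borel (\<lambda>p. 1 - p)) x = cdf (distr \<mu> borel (\<lambda>p. p)) x"
        by (simp only: cdf_def measure_distr[OF id] measure_distr[OF refl] space
            borel_closed closed_atMost)
    qed
  qed
  then have "integral\<^sup>L (distr \<mu> borel (\<lambda>p. 1 - p)) f = integral\<^sup>L (distr \<mu> borel (\<lambda>p. p)) f"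
    by simp
  then show ?thesis
    using f by (simp add: integral_distr)
qed

section \<open>Limits of the success rates\<close>

theorem theorem5p3:
  fixes w :: "nat \<Rightarrow> real" and r :: real and \<mu> :: "real measure" and v :: nat
  assumes w_nonneg: "\<And>n. n \<ge> 1 \<Longrightarrow> w n \<ge> 0"
    and mu_prob: "prob_measure_on_unit_interval \<mu>"
    and mu_sym: "symmetric_about_half \<mu>"
    and vs: "eventually (\<lambda>N. voting_system (voters N) (winning w r N)) sequentially"
    and LT: "laakso_taagepera w \<longlonglongrightarrow> 0"
    and mu_r: "measure \<mu> {r} = 0"
    and v: "v \<ge> 1"
  shows "(\<lambda>N. affirmative_success (common_belief_measure \<mu> N) (winning w r N) v)
           \<longlonglongrightarrow> (LINT p:{r..1}|\<mu>. p) \<and>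
         (\<lambda>N. blocking_success (common_belief_measure \<mu> N) (voters N) (winning w r N) v)
           \<longlonglongrightarrow> (LINT p:{1 - r..1}|\<mu>. p)"
proof
  note space = space_unit_interval_measure[OF mu_prob]
  obtain N0 where "voting_system (voters N0) (winning w r N0)"
    using eventually_happens'[OF sequentially_bot vs] by blast
  from voting_system_winningD[OF this w_nonneg] have r: "0 < r" "r \<le> 1" by auto
  have member: "eventually (\<lambda>N. bernoulli_expectation p (voters N) (\<lambda>A. of_bool (v \<in> A)) = p)
      sequentially" for p
    using eventually_ge_at_top[of v]
  proof eventually_elim
    case (elim N)
    with v show ?case by (intro bernoulli_prob_member) (auto simp: voters_def)
  qed
  have nonmember: "eventually (\<lambda>N. bernoulli_expectation p (voters N) (\<lambda>A. of_bool (v \<notin> A)) = 1 - p)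
      sequentially" for p
    using member[of p]
  proof eventually_elim
    case (elim N)
    have "bernoulli_expectation p (voters N) (\<lambda>A. of_bool (v \<notin> A)) =
        bernoulli_expectation p (voters N) (\<lambda>A. 1 - of_bool (v \<in> A))"
      by (simp add: of_bool_not_iff)
    also have "\<dots> = 1 - p"
      unfolding bernoulli_expectation_diff elim
      by (simp add: bernoulli_expectation_const voters_def)
    finally show ?case .
  qed

  show "(\<lambda>N. affirmative_success (common_belief_measure \<mu> N) (winning w r N) v)
           \<longlonglongrightarrow> (LINT p:{r..1}|\<mu>. p)"
  proof -
    have "{A \<in> winning w r N. v \<in> A} =
        {A. A \<subseteq> voters N \<and> (A \<in> winning w r N \<and> v \<in> A)}" for N
      by (auto simp: winning_def)
    then have "affirmative_success (common_belief_measure \<mu> N) (winning w r N) v =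
        (LINT p|\<mu>. bernoulli_expectation p (voters N)
          (\<lambda>A. of_bool (A \<in> winning w r N) * of_bool (v \<in> A)))" for N
      by (simp only: affirmative_success_def measure_common_belief_measure[OF mu_prob] of_bool_conj)
    moreover have "(\<lambda>N. LINT p|\<mu>. bernoulli_expectation p (voters N)
          (\<lambda>A. of_bool (A \<in> winning w r N) * of_bool (v \<in> A)))
        \<longlonglongrightarrow> (LINT p|\<mu>. of_bool (r \<le> p) * p)"
    proof (rule integral_bernoulli_expectation_tendsto[OF mu_prob mu_r r])
      fix p :: real assume "0 \<le> p" "p \<le> 1" "p \<noteq> r"
      then show "(\<lambda>N. bernoulli_expectation p (voters N)
            (\<lambda>A. of_bool (A \<in> winning w r N) * of_bool (v \<in> A)))
          \<longlonglongrightarrow> of_bool (r \<le> p) * p"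
        by (intro bernoulli_winning_tendsto[OF w_nonneg vs LT] member) auto
    qed auto
    moreover have "(LINT p|\<mu>. of_bool (r \<le> p) * p) = (LINT p:{r..1}|\<mu>. p)"
      unfolding set_lebesgue_integral_def
      by (rule Bochner_Integration.integral_cong) (auto simp: space indicator_def)
    ultimately show ?thesis by simp
  qed

  show "(\<lambda>N. blocking_success (common_belief_measure \<mu> N) (voters N) (winning w r N) v)
           \<longlonglongrightarrow> (LINT p:{1 - r..1}|\<mu>. p)"
  proof -
    have lose: "(of_bool (A \<notin> winning w r N \<and> v \<notin> A) :: real) =
        of_bool (v \<notin> A) - of_bool (A \<in> winning w r N) * of_bool (v \<notin> A)" for A N
      by simp
    have "blocking_success (common_belief_measure \<mu> N) (voters N) (winning w r N) v =
        (LINT p|\<mu>. bernoulli_expectation p (voters N)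
          (\<lambda>A. of_bool (A \<notin> winning w r N \<and> v \<notin> A)))" for N
      by (simp only: blocking_success_def measure_common_belief_measure[OF mu_prob])
    moreover have "(\<lambda>N. LINT p|\<mu>. bernoulli_expectation p (voters N)
          (\<lambda>A. of_bool (A \<notin> winning w r N \<and> v \<notin> A)))
        \<longlonglongrightarrow> (LINT p|\<mu>. of_bool (1 - r \<le> 1 - p) * (1 - p))"
    proof (rule integral_bernoulli_expectation_tendsto[OF mu_prob mu_r r])
      fix p :: real assume p: "0 \<le> p" "p \<le> 1" "p \<noteq> r"
      have "(\<lambda>N. bernoulli_expectation p (voters N) (\<lambda>A. of_bool (v \<notin> A)) -
            bernoulli_expectation p (voters N)
              (\<lambda>A. of_bool (A \<in> winning w r N) * of_bool (v \<notin> A)))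
          \<longlonglongrightarrow> (1 - p) - of_bool (r \<le> p) * (1 - p)"
        using p nonmember
        by (intro tendsto_diff tendsto_eventually bernoulli_winning_tendsto[OF w_nonneg vs LT]) auto
      \<comment> \<open>The two forms of the limit agree off the null set \<open>{r}\<close>; the closed condition is the one
        that reflects to \<open>{1 - r..1}\<close>.\<close>
      moreover have "(1 - p) - of_bool (r \<le> p) * (1 - p) = of_bool (1 - r \<le> 1 - p) * (1 - p)"
        using p by (simp add: of_bool_def)
      ultimately show "(\<lambda>N. bernoulli_expectation p (voters N)
            (\<lambda>A. of_bool (A \<notin> winning w r N \<and> v \<notin> A)))
          \<longlonglongrightarrow> of_bool (1 - r \<le> 1 - p) * (1 - p)"
        unfolding lose bernoulli_expectation_diff by simp
    qed auto
    moreover have "(LINT p|\<mu>. of_bool (1 - r \<le> 1 - p) * (1 - p)) =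
        (LINT p|\<mu>. of_bool (1 - r \<le> p) * p)"
      by (rule integral_reflect_symmetric[OF mu_prob mu_sym]) auto
    moreover have "(LINT p|\<mu>. of_bool (1 - r \<le> p) * p) = (LINT p:{1 - r..1}|\<mu>. p)"
      unfolding set_lebesgue_integral_def
      by (rule Bochner_Integration.integral_cong) (auto simp: space indicator_def)
    ultimately show ?thesis by simp
  qed
qed

end
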